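(* Let $X,Y$ be Hilbert spaces, $f:X\to[-\infty,+\infty]$ a proper function, $y_0\in Y$, and $p:X\times Y\to[-\infty,+\infty]$ a function with $p(x,y_0)=f(x)$ for all $x\in X$. Assume that for all $x\in X$ the function $p(x,\cdot)$ is $\Psi_{lsc}$-convex at $y_0$. Let $\mathcal{L}:X\times\Psi_{lsc}\to[-\infty,+\infty]$ be defined, for $\psi(y)=-a\|y\|^2+\langle v,y\rangle+c$, by $$\mathcal{L}(x,\psi)=-a\|y_0\|^2+\langle v,y_0\rangle+c-p_x^*(\psi),\qquad p_x^*(\psi)=\sup_{y\in Y}\{-a\|y\|^2+\langle v,y\rangle+c-p(x,y)\}.$$ Assume that for any $\psi\in\Psi_{lsc}$ the function $\mathcal{L}(\cdot,\psi):X\to[-\infty,+\infty]$ is $\Phi_{lsc}$-convex on $X$. Then the following are equivalent: (i) for every $\alpha\in\mathbb{R}$ with $\alpha<\inf_{x\in X}\sup_{\psi\in\Psi_{lsc}}\mathcal{L}(x,\psi)$ there exist $\psi_1,\psi_2\in\Psi_{lsc}$, $\varphi_1\in\operatorname{supp}\mathcal{L}(\cdot,\psi_1)$ and $\varphi_2\in\operatorname{supp}\mathcal{L}(\cdot,\psi_2)$ such that $[\varphi_1<\alpha]\cap[\varphi_2<\alpha]=\emptyset$; (ii) $\displaystyle \inf_{x\in X} f(x)=\sup_{\psi\in\Psi_{lsc}}\inf_{x\in X}\mathcal{L}(x,\psi)=\inf_{x\in X}\sup_{\psi\in\Psi_{lsc}}\mathcal{L}(x,\psi).$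
   Context: Hilbert spaces are real. A function $f:X\to[-\infty,+\infty]$ is proper if $\{x: f(x)<+\infty\}\ne\emptyset$ and $f(x)>-\infty$ for all $x$. $\Phi_{lsc}$ is the set of all functions $\varphi:X\to\mathbb{R}$ of the form $\varphi(x)=-a\|x\|^2+\langle \ell,x\rangle+c$ with $a\ge0$, $\ell\in X^*$ (identified with $X$), $c\in\mathbb{R}$; $\Psi_{lsc}$ is the analogous set of functions $\psi(y)=-a\|y\|^2+\langle v,y\rangle+c$ on $Y$, $a\ge 0$, $v\in Y$, $c\in\mathbb{R}$. For a set $\Phi$ of real-valued functions on $X$ and $h:X\to[-\infty,+\infty]$, $\operatorname{supp}(h)=\{\varphi\in\Phi:\varphi\le h\text{ on }X\}$; $h$ is $\Phi$-convex at $x_0$ if $h(x_0)=\sup\{\varphi(x_0):\varphi\in\operatorname{supp}(h)\}$, and $\Phi$-convex on $X$ if this holds at every point ($\sup\emptyset=-\infty$). The same applies to $\Psi_{lsc}$ on $Y$. In (i), supports are with respect to $\Phi_{lsc}$, and $[\varphi<\alpha]=\{x\in X:\varphi(x)<\alpha\}$. *)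

theory Defs
  imports "HOL-Analysis.Analysis"
begin

definition proper :: "('a \<Rightarrow> ereal) \<Rightarrow> bool" where
  "proper f \<longleftrightarrow> {x. f x < \<infinity>} \<noteq> {} \<and> (\<forall>x. f x > -\<infinity>)"

text \<open>Continuous linear functionals are represented by vectors of the Hilbert space (Riesz).\<close>

definition Phi_lsc :: "('a::real_inner \<Rightarrow> real) set" where
  "Phi_lsc = {\<phi>. \<exists>a l c. a \<ge> 0 \<and> \<phi> = (\<lambda>x. - a * (norm x)\<^sup>2 + l \<bullet> x + c)}"

abbreviation (input) Psi_lsc :: "('b::real_inner \<Rightarrow> real) set" where
  "Psi_lsc \<equiv> Phi_lsc"

definition supp :: "('a \<Rightarrow> real) set \<Rightarrow> ('a \<Rightarrow> ereal) \<Rightarrow> ('a \<Rightarrow> real) set" where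
  "supp \<Phi> h = {\<phi> \<in> \<Phi>. \<forall>x. ereal (\<phi> x) \<le> h x}"

text \<open>The supremum is taken in \<^typ>\<open>ereal\<close>, so that it is \<open>-\<infinity>\<close> for an empty support.\<close>

definition abs_convex_at :: "('a \<Rightarrow> real) set \<Rightarrow> ('a \<Rightarrow> ereal) \<Rightarrow> 'a \<Rightarrow> bool" where
  "abs_convex_at \<Phi> h x0 \<longleftrightarrow> h x0 = (SUP \<phi>\<in>supp \<Phi> h. ereal (\<phi> x0))"

definition abs_convex :: "('a \<Rightarrow> real) set \<Rightarrow> ('a \<Rightarrow> ereal) \<Rightarrow> bool" where
  "abs_convex \<Phi> h \<longleftrightarrow> (\<forall>x0. abs_convex_at \<Phi> h x0)"

text \<open>Both differences below have a finite minuend, so the indeterminate form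
  \<open>\<infinity> - \<infinity>\<close> never occurs.\<close>

definition conjugate :: "('b \<Rightarrow> ereal) \<Rightarrow> ('b \<Rightarrow> real) \<Rightarrow> ereal" where
  "conjugate h \<psi> = (SUP y. ereal (\<psi> y) - h y)"

definition lagrangian ::
  "('a \<Rightarrow> 'b \<Rightarrow> ereal) \<Rightarrow> 'b \<Rightarrow> 'a \<Rightarrow> ('b \<Rightarrow> real) \<Rightarrow> ereal" where
  "lagrangian p y0 x \<psi> = ereal (\<psi> y0) - conjugate (p x) \<psi>"

definition strict_sublevel :: "('a \<Rightarrow> real) \<Rightarrow> real \<Rightarrow> 'a set" where
  "strict_sublevel \<phi> \<alpha> = {x. \<phi> x < \<alpha>}"

end

theory Submission
  imports Defs
begin

text \<open>Only real lower bounds of the Lagrangian matter: \<open>r \<le> \<L>(x,\<psi>)\<close> says that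
  \<open>\<psi> - \<psi>(y\<^sub>0) + r\<close> is a minorant of \<open>p(x,\<cdot>)\<close>. Hence \<open>sup\<^sub>\<psi> \<L>(x,\<psi>) = f(x)\<close>, and lower bounds are
  preserved by convex combinations in \<open>\<psi>\<close>. The implication from (ii) to (i) takes a constant function
  for both minorants. For the converse, two functions in \<open>\<Phi>\<^sub>l\<^sub>s\<^sub>c\<close> whose strict sublevel sets
  at \<open>\<alpha>\<close> are disjoint have a convex combination that is at least \<open>\<alpha>\<close> everywhere: unless one of them is
  itself at least \<open>\<alpha>\<close>, moving far away excludes quadratic terms and forces antiparallel slopes.
  The same convex combination of the two \<open>\<psi>\<^sub>i\<close> then has \<open>\<L>(\<cdot>,\<psi>) \<ge> \<alpha>\<close>.\<close>

section \<open>Closure of \<open>Phi_lsc\<close> under convex combinations\<close>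

lemma Phi_lscI: "a \<ge> 0 \<Longrightarrow> (\<lambda>x. - a * (norm x)\<^sup>2 + l \<bullet> x + c) \<in> Phi_lsc"
  unfolding Phi_lsc_def by blast

lemma const_in_Phi_lsc: "(\<lambda>x. c) \<in> Phi_lsc"
  using Phi_lscI[of 0 0 c] by simp

lemma Phi_lsc_convex_combination:
  assumes "\<phi> \<in> Phi_lsc" "\<psi> \<in> Phi_lsc" "0 \<le> t" "t \<le> 1"
  shows "(\<lambda>x. t * \<phi> x + (1 - t) * \<psi> x) \<in> Phi_lsc"
proof -
  obtain a l c where a: "a \<ge> 0" and \<phi>: "\<phi> = (\<lambda>x. - a * (norm x)\<^sup>2 + l \<bullet> x + c)"
    using assms(1) unfolding Phi_lsc_def by blast
  obtain b m d where b: "b \<ge> 0" and \<psi>: "\<psi> = (\<lambda>x. - b * (norm x)\<^sup>2 + m \<bullet> x + d)"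
    using assms(2) unfolding Phi_lsc_def by blast
  have "(\<lambda>x. t * \<phi> x + (1 - t) * \<psi> x) =
      (\<lambda>x. - (t * a + (1 - t) * b) * (norm x)\<^sup>2 + (t *\<^sub>R l + (1 - t) *\<^sub>R m) \<bullet> x + (t * c + (1 - t) * d))"
    by (rule ext) (simp add: \<phi> \<psi> inner_add_left algebra_simps)
  also have "\<dots> \<in> Phi_lsc"
    using a b assms(3,4) by (intro Phi_lscI) simp
  finally show ?thesis .
qed

section \<open>Intersecting strict sublevel sets of functions in \<open>Phi_lsc\<close>\<close>

lemma Phi_lsc_translate_line:
  fixes x d :: "'a::real_inner"
  shows "- a * (norm (x + s *\<^sub>R d))\<^sup>2 + l \<bullet> (x + s *\<^sub>R d) + c =
    (- a * (norm x)\<^sup>2 + l \<bullet> x + c) + s * (l \<bullet> d - 2 * a * (x \<bullet> d)) - a * s\<^sup>2 * (norm d)\<^sup>2"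
  unfolding power2_norm_eq_inner
  by (simp add: inner_add_left inner_add_right inner_commute algebra_simps power2_eq_square)

lemma eventually_affine_minus_square_less:
  fixes A B C \<alpha> :: real
  assumes "C > 0"
  shows "eventually (\<lambda>s. A + s * B - C * s\<^sup>2 < \<alpha>) at_top"
proof -
  \<comment> \<open>Past the threshold, \<open>C * s\<close> exceeds the sum of the absolute values;
    multiplying by \<open>s \<ge> 1\<close> lets the square absorb \<open>A\<close>,
    \<open>s * B\<close> and \<alpha> together.\<close>
  have "eventually (\<lambda>s. s \<ge> 1 \<and> s > (\<bar>A\<bar> + \<bar>B\<bar> + \<bar>\<alpha>\<bar>) / C) at_top"
    by (intro eventually_conj eventually_ge_at_top eventually_gt_at_top)
  then show ?thesis
  proof eventually_elim
    case (elim s)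
    then have "\<bar>A\<bar> + \<bar>B\<bar> + \<bar>\<alpha>\<bar> < C * s"
      using assms by (simp add: divide_less_eq mult.commute)
    then have "s * (\<bar>A\<bar> + \<bar>B\<bar> + \<bar>\<alpha>\<bar>) < s * (C * s)"
      using elim by (intro mult_strict_left_mono) auto
    moreover have "\<bar>A\<bar> \<le> s * \<bar>A\<bar>" "\<bar>\<alpha>\<bar> \<le> s * \<bar>\<alpha>\<bar>"
      using elim by (auto intro: mult_right_mono[of 1 s, simplified])
    moreover have "s * B \<le> s * \<bar>B\<bar>"
      using elim by (intro mult_left_mono) auto
    ultimately show ?case
      by (simp add: power2_eq_square algebra_simps)
  qed
qed

text \<open>Start at \<open>x2\<close>, where the second function is already below \<alpha>, and
  move along a ray on which it does not increase; the first function tends to minus infinity there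
  because \<open>a > 0\<close>. The point \<open>x1\<close> supplies a nonzero direction.\<close>

lemma strict_sublevels_meet_if_quadratic:
  fixes x1 x2 :: "'a::real_inner"
  assumes "a > 0" "b \<ge> 0" "x1 \<noteq> x2"
    and x2: "- b * (norm x2)\<^sup>2 + m \<bullet> x2 + d < \<alpha>"
  shows "\<exists>x. - a * (norm x)\<^sup>2 + l \<bullet> x + c < \<alpha> \<and> - b * (norm x)\<^sup>2 + m \<bullet> x + d < \<alpha>"
proof -
  \<comment> \<open>The tested number is the directional derivative of the second function at
    \<open>x2\<close>. Choosing the sign of the direction makes it nonpositive, and by concavity the
    function then stays below \<alpha> along the whole ray.\<close>
  define e where "e = (if m \<bullet> (x1 - x2) - 2 * b * (x2 \<bullet> (x1 - x2)) \<le> 0 then x1 - x2 else x2 - x1)"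
  have e: "e \<noteq> 0" "m \<bullet> e - 2 * b * (x2 \<bullet> e) \<le> 0"
    using assms(3) by (auto simp: e_def inner_diff_right algebra_simps)
  let ?A = "- a * (norm x2)\<^sup>2 + l \<bullet> x2 + c"
  have "eventually (\<lambda>s. ?A + s * (l \<bullet> e - 2 * a * (x2 \<bullet> e)) - (a * (norm e)\<^sup>2) * s\<^sup>2 < \<alpha>) at_top"
    using assms(1) e(1) by (intro eventually_affine_minus_square_less) simp
  then have "eventually (\<lambda>s. s \<ge> 0 \<and>
      ?A + s * (l \<bullet> e - 2 * a * (x2 \<bullet> e)) - (a * (norm e)\<^sup>2) * s\<^sup>2 < \<alpha>) at_top"
    by (intro eventually_conj eventually_ge_at_top)
  then obtain s where s: "s \<ge> 0"
    "?A + s * (l \<bullet> e - 2 * a * (x2 \<bullet> e)) - (a * (norm e)\<^sup>2) * s\<^sup>2 < \<alpha>"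
    using eventually_happens'[OF trivial_limit_at_top_linorder] by (metis (no_types, lifting))
  have "s * (m \<bullet> e - 2 * b * (x2 \<bullet> e)) \<le> 0" "b * s\<^sup>2 * (norm e)\<^sup>2 \<ge> 0"
    using s(1) e(2) assms(2) by (auto intro: mult_nonneg_nonpos)
  then have "- b * (norm (x2 + s *\<^sub>R e))\<^sup>2 + m \<bullet> (x2 + s *\<^sub>R e) + d < \<alpha>"
    using x2 unfolding Phi_lsc_translate_line by linarith
  moreover have "- a * (norm (x2 + s *\<^sub>R e))\<^sup>2 + l \<bullet> (x2 + s *\<^sub>R e) + c < \<alpha>"
    using s(2) unfolding Phi_lsc_translate_line by (simp add: mult_ac)
  ultimately show ?thesis
    by blast
qed

text \<open>Rescale both slopes to the common length \<open>norm l * norm m\<close>; the negative of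
  their sum is a direction in which both affine functions strictly decrease. A zero slope would make
  this sum vanish, so it is excluded.\<close>

lemma open_halfspaces_meet_if_not_antiparallel:
  fixes l m :: "'a::real_inner"
  assumes "norm m *\<^sub>R l + norm l *\<^sub>R m \<noteq> 0"
  shows "\<exists>x. l \<bullet> x + c < \<alpha> \<and> m \<bullet> x + d < \<alpha>"
proof -
  define e where "e = - (norm m *\<^sub>R l + norm l *\<^sub>R m)"
  \<comment> \<open>This is the slack in the Cauchy-Schwarz inequality for \<open>l\<close> and
    \<open>- m\<close>. It is nonnegative, and positive as soon as \<open>e\<close> is
    nonzero.\<close>
  define k where "k = norm l * norm m + l \<bullet> m"
  have ll: "l \<bullet> l = norm l * norm l" and mm: "m \<bullet> m = norm m * norm m"
    by (simp_all add: dot_square_norm power2_eq_square)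
  have "e \<bullet> e = 2 * norm l * norm m * k"
    by (simp add: e_def k_def inner_add_left inner_add_right inner_commute ll mm algebra_simps)
  moreover have "e \<noteq> 0"
    using assms unfolding e_def by (simp only: neg_equal_0_iff_equal not_False_eq_True)
  then have "e \<bullet> e > 0"
    by simp
  moreover have "k \<ge> 0"
    using Cauchy_Schwarz_ineq2[of l m] unfolding k_def by linarith
  ultimately have k: "k > 0" "norm l > 0" "norm m > 0"
    by (auto simp: zero_less_mult_iff order.order_iff_strict)
  have le: "l \<bullet> e = - (norm l * k)" "m \<bullet> e = - (norm m * k)"
    by (simp_all add: e_def k_def inner_add_right inner_commute ll mm algebra_simps)
  \<comment> \<open>The two quotients are the parameters at which the functions reach \<alpha> along
    \<open>e\<close>; adding 1 gives strict inequality for both.\<close>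
  define s where "s = max ((c - \<alpha>) / (norm l * k)) ((d - \<alpha>) / (norm m * k)) + 1"
  have "(c - \<alpha>) / (norm l * k) < s" "(d - \<alpha>) / (norm m * k) < s"
    unfolding s_def by linarith+
  then have "l \<bullet> (s *\<^sub>R e) + c < \<alpha> \<and> m \<bullet> (s *\<^sub>R e) + d < \<alpha>"
    using k by (simp add: le divide_less_eq algebra_simps)
  then show ?thesis ..
qed

lemma convex_combination_ge_if_strict_sublevels_disjoint:
  fixes \<phi> \<psi> :: "'a::real_inner \<Rightarrow> real"
  assumes "\<phi> \<in> Phi_lsc" "\<psi> \<in> Phi_lsc"
    and disj: "strict_sublevel \<phi> \<alpha> \<inter> strict_sublevel \<psi> \<alpha> = {}"
  obtains t where "0 \<le> t" "t \<le> 1" "\<And>x. t * \<phi> x + (1 - t) * \<psi> x \<ge> \<alpha>"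
proof -
  have disj': "\<not> (\<phi> x < \<alpha> \<and> \<psi> x < \<alpha>)" for x
    using disj unfolding strict_sublevel_def by blast
  consider (left) "\<forall>x. \<phi> x \<ge> \<alpha>" | (right) "\<forall>x. \<psi> x \<ge> \<alpha>"
    | (neither) x1 x2 where "\<phi> x1 < \<alpha>" "\<psi> x2 < \<alpha>"
    by (meson not_le)
  then show thesis
  proof cases
    case left
    then show ?thesis using that[of 1] by simp
  next
    case right
    then show ?thesis using that[of 0] by simp
  next
    case neither
    obtain a l c where a: "a \<ge> 0" and \<phi>: "\<phi> = (\<lambda>x. - a * (norm x)\<^sup>2 + l \<bullet> x + c)"
      using assms(1) unfolding Phi_lsc_def by blast
    obtain b m d where b: "b \<ge> 0" and \<psi>: "\<psi> = (\<lambda>x. - b * (norm x)\<^sup>2 + m \<bullet> x + d)"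
      using assms(2) unfolding Phi_lsc_def by blast
    have ne: "x1 \<noteq> x2"
      using neither disj' by blast
    have "a = 0"
    proof (rule ccontr)
      assume "a \<noteq> 0"
      then have "\<exists>x. \<phi> x < \<alpha> \<and> \<psi> x < \<alpha>"
        using strict_sublevels_meet_if_quadratic[of a b x1 x2 m d \<alpha> l c] a b ne neither(2)
        unfolding \<phi> \<psi> by simp
      then show False using disj' by blast
    qed
    moreover have "b = 0"
    proof (rule ccontr)
      assume "b \<noteq> 0"
      then have "\<exists>x. \<psi> x < \<alpha> \<and> \<phi> x < \<alpha>"
        using strict_sublevels_meet_if_quadratic[of b a x2 x1 l c \<alpha> m d] a b ne neither(1)
        unfolding \<phi> \<psi> by simp
      then show False using disj' by blast
    qed
    ultimately have \<phi>: "\<phi> = (\<lambda>x. l \<bullet> x + c)" and \<psi>: "\<psi> = (\<lambda>x. m \<bullet> x + d)"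
      using \<phi> \<psi> by simp_all
    \<comment> \<open>With slope zero a function would be constant and below \<alpha> everywhere, in
      particular at the point where the other one is below \<alpha>.\<close>
    have "l \<noteq> 0" "m \<noteq> 0"
      using neither disj'[of x1] disj'[of x2] by (auto simp: \<phi> \<psi>)
    then have pos: "norm l > 0" "norm m > 0"
      by simp_all
    have anti: "norm m *\<^sub>R l + norm l *\<^sub>R m = 0"
      using open_halfspaces_meet_if_not_antiparallel[of m l c \<alpha> d] disj' by (auto simp: \<phi> \<psi>)
    \<comment> \<open>Each slope is weighted by the norm of the other, so that the antiparallel
      slopes cancel and the combination is a constant \<open>K\<close>.\<close>
    define t where "t = norm m / (norm l + norm m)"
    have t: "0 \<le> t" "t < 1" "1 - t = norm l / (norm l + norm m)"
      using pos add_pos_pos[OF pos] unfolding t_def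
      by (simp_all add: field_simps del: zero_less_norm_iff)
    define K where "K = t * c + (1 - t) * d"
    have comb: "t * \<phi> x + (1 - t) * \<psi> x = K" for x
    proof -
      have "t * (l \<bullet> x) + (1 - t) * (m \<bullet> x)
          = ((norm m *\<^sub>R l + norm l *\<^sub>R m) \<bullet> x) / (norm l + norm m)"
        unfolding t(3) unfolding t_def by (simp add: inner_add_left add_divide_distrib)
      also have "\<dots> = 0"
        by (simp only: anti inner_zero_left div_0)
      finally show ?thesis
        by (simp add: \<phi> \<psi> K_def algebra_simps)
    qed
    have "K \<ge> \<alpha>"
    proof (rule ccontr)
      assume K: "\<not> K \<ge> \<alpha>"
      \<comment> \<open>On the line spanned by \<open>l\<close>, this is the point where \<phi>
        equals \<open>K\<close>. Since \<open>t < 1\<close>, the constant combination forces \<psi>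
        to equal \<open>K\<close> there too, so \<open>K < \<alpha>\<close> would put
        \<open>z\<close> in both sublevel sets.\<close>
      define z where "z = ((K - c) / (l \<bullet> l)) *\<^sub>R l"
      have "\<phi> z = K"
        using \<open>l \<noteq> 0\<close> by (simp add: \<phi> z_def)
      moreover from this have "(1 - t) * (\<psi> z - K) = 0"
        using comb[of z] by (simp add: algebra_simps)
      then have "\<psi> z = K"
        using t(2) by simp
      ultimately show False
        using disj'[of z] K by simp
    qed
    then show ?thesis
      using that[of t] t comb by simp
  qed
qed

section \<open>Real lower bounds of the Lagrangian\<close>

lemma le_lagrangian_iff:
  "ereal r \<le> lagrangian p y0 x \<psi> \<longleftrightarrow> (\<forall>y. ereal (\<psi> y - \<psi> y0 + r) \<le> p x y)"
proof -
  \<comment> \<open>Because \<open>r\<close> and the values of \<psi> are finite, they can be moved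
    across the differences even where the conjugate or \<open>p x y\<close> is infinite.\<close>
  have "ereal r \<le> lagrangian p y0 x \<psi> \<longleftrightarrow> conjugate (p x) \<psi> \<le> ereal (\<psi> y0 - r)"
    unfolding lagrangian_def by (cases "conjugate (p x) \<psi>") auto
  also have "\<dots> \<longleftrightarrow> (\<forall>y. ereal (\<psi> y) - p x y \<le> ereal (\<psi> y0 - r))"
    unfolding conjugate_def by (simp add: SUP_le_iff)
  also have "\<dots> \<longleftrightarrow> (\<forall>y. ereal (\<psi> y - \<psi> y0 + r) \<le> p x y)"
  proof (rule all_cong1)
    fix y
    show "ereal (\<psi> y) - p x y \<le> ereal (\<psi> y0 - r) \<longleftrightarrow> ereal (\<psi> y - \<psi> y0 + r) \<le> p x y"
      by (cases "p x y") auto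
  qed
  finally show ?thesis .
qed

text \<open>Testing the minorant condition at \<open>y0\<close> bounds every value of the Lagrangian
  by \<open>p x y0\<close>. Conversely, a \<psi> in the support has the lower bound
  \<open>\<psi> y0\<close>, and convexity at \<open>y0\<close> says that these numbers have supremum
  \<open>p x y0\<close>.\<close>

lemma SUP_lagrangian:
  assumes "abs_convex_at \<Psi> (p x) y0"
  shows "(SUP \<psi>\<in>\<Psi>. lagrangian p y0 x \<psi>) = p x y0"
proof (rule antisym)
  have "lagrangian p y0 x \<psi> \<le> p x y0" for \<psi>
  proof (rule ccontr)
    assume "\<not> lagrangian p y0 x \<psi> \<le> p x y0"
    then obtain r where r: "p x y0 < ereal r" "ereal r < lagrangian p y0 x \<psi>"
      using ereal_dense2[of "p x y0" "lagrangian p y0 x \<psi>"] by (auto simp: not_le)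
    then have "ereal r \<le> p x y0"
      using le_lagrangian_iff[of r p y0 x \<psi>] by (auto dest: spec[of _ y0])
    with r(1) show False
      by simp
  qed
  then show "(SUP \<psi>\<in>\<Psi>. lagrangian p y0 x \<psi>) \<le> p x y0"
    by (intro SUP_least)
next
  have "ereal (\<psi> y0) \<le> lagrangian p y0 x \<psi>" if "\<psi> \<in> supp \<Psi> (p x)" for \<psi>
    using that unfolding le_lagrangian_iff supp_def by simp
  then have "(SUP \<psi>\<in>supp \<Psi> (p x). ereal (\<psi> y0)) \<le> (SUP \<psi>\<in>\<Psi>. lagrangian p y0 x \<psi>)"
    by (intro SUP_mono) (auto simp: supp_def)
  then show "p x y0 \<le> (SUP \<psi>\<in>\<Psi>. lagrangian p y0 x \<psi>)"
    using assms unfolding abs_convex_at_def by simp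
qed

lemma le_lagrangian_convex_combination:
  assumes "ereal r \<le> lagrangian p y0 x \<psi>1" "ereal s \<le> lagrangian p y0 x \<psi>2" "0 \<le> t" "t \<le> 1"
  shows "ereal (t * r + (1 - t) * s) \<le> lagrangian p y0 x (\<lambda>y. t * \<psi>1 y + (1 - t) * \<psi>2 y)"
  unfolding le_lagrangian_iff
proof
  fix y
  define A B where "A = \<psi>1 y - \<psi>1 y0 + r" and "B = \<psi>2 y - \<psi>2 y0 + s"
  have "ereal A \<le> p x y" "ereal B \<le> p x y"
    using assms(1,2) unfolding le_lagrangian_iff A_def B_def by blast+
  \<comment> \<open>Comparing with the maximum, which is one of the two real minorant values, avoids
    multiplying the possibly infinite \<open>p x y\<close> by weights.\<close>
  moreover have "t * A + (1 - t) * B \<le> max A B"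
    using assms(3,4) by (intro convex_bound_le) auto
  ultimately have "ereal (t * A + (1 - t) * B) \<le> p x y"
    by (metis ereal_less_eq(3) max_def order_trans)
  then show "ereal (t * \<psi>1 y + (1 - t) * \<psi>2 y - (t * \<psi>1 y0 + (1 - t) * \<psi>2 y0) +
      (t * r + (1 - t) * s)) \<le> p x y"
    by (simp add: A_def B_def algebra_simps)
qed

theorem theorem6:
  fixes f :: "'a::{real_inner, complete_space} \<Rightarrow> ereal"
    and p :: "'a \<Rightarrow> 'b::{real_inner, complete_space} \<Rightarrow> ereal"
    and y0 :: 'b
  assumes "proper f"
    and "\<And>x. p x y0 = f x"
    and "\<And>x. abs_convex_at Psi_lsc (p x) y0"
    and "\<And>\<psi>. \<psi> \<in> Psi_lsc \<Longrightarrow> abs_convex Phi_lsc (\<lambda>x. lagrangian p y0 x \<psi>)"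
  shows "(\<forall>\<alpha>::real. ereal \<alpha> < (INF x. SUP \<psi>\<in>Psi_lsc. lagrangian p y0 x \<psi>) \<longrightarrow>
            (\<exists>\<psi>1\<in>Psi_lsc. \<exists>\<psi>2\<in>Psi_lsc.
              \<exists>\<phi>1\<in>supp Phi_lsc (\<lambda>x. lagrangian p y0 x \<psi>1).
              \<exists>\<phi>2\<in>supp Phi_lsc (\<lambda>x. lagrangian p y0 x \<psi>2).
                strict_sublevel \<phi>1 \<alpha> \<inter> strict_sublevel \<phi>2 \<alpha> = {}))
         \<longleftrightarrow>
         ((INF x. f x) = (SUP \<psi>\<in>Psi_lsc. INF x. lagrangian p y0 x \<psi>) \<and>
          (SUP \<psi>\<in>Psi_lsc. INF x. lagrangian p y0 x \<psi>) =
            (INF x. SUP \<psi>\<in>Psi_lsc. lagrangian p y0 x \<psi>))"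
    (is "?i \<longleftrightarrow> ?ii")
proof -
  let ?L = "lagrangian p y0"
  \<comment> \<open>This turns the inf-sup into the infimum of \<open>f\<close>, so both equalities
    in (ii) amount to strong duality.\<close>
  have sup: "(SUP \<psi>\<in>Psi_lsc. ?L x \<psi>) = f x" for x
    using SUP_lagrangian[of Psi_lsc p x y0] assms(2,3) by simp
  show ?thesis
  proof
    assume i: ?i
    have le: "ereal \<alpha> \<le> (SUP \<psi>\<in>Psi_lsc. INF x. ?L x \<psi>)" if \<alpha>: "ereal \<alpha> < (INF x. f x)" for \<alpha>
    proof -
      obtain \<psi>1 \<psi>2 \<phi>1 \<phi>2 where \<psi>: "\<psi>1 \<in> Psi_lsc" "\<psi>2 \<in> Psi_lsc"
        and \<phi>1: "\<phi>1 \<in> supp Phi_lsc (\<lambda>x. ?L x \<psi>1)"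
        and \<phi>2: "\<phi>2 \<in> supp Phi_lsc (\<lambda>x. ?L x \<psi>2)"
        and disj: "strict_sublevel \<phi>1 \<alpha> \<inter> strict_sublevel \<phi>2 \<alpha> = {}"
        using i \<alpha> unfolding sup by blast
      obtain t where t: "0 \<le> t" "t \<le> 1" and ge: "\<And>x. t * \<phi>1 x + (1 - t) * \<phi>2 x \<ge> \<alpha>"
        using convex_combination_ge_if_strict_sublevels_disjoint[of \<phi>1 \<phi>2 \<alpha>] \<phi>1 \<phi>2 disj
        unfolding supp_def by blast
      \<comment> \<open>The weight found for the minorants \<phi>1 and \<phi>2 is reused on the dual
        side, giving a single \<psi> whose Lagrangian is at least \<alpha> for all
        \<open>x\<close>.\<close>
      define \<psi> where "\<psi> = (\<lambda>y. t * \<psi>1 y + (1 - t) * \<psi>2 y)"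
      have "ereal \<alpha> \<le> ?L x \<psi>" for x
      proof -
        have "ereal (t * \<phi>1 x + (1 - t) * \<phi>2 x) \<le> ?L x \<psi>"
          using \<phi>1 \<phi>2 t unfolding \<psi>_def supp_def
          by (intro le_lagrangian_convex_combination) auto
        then show ?thesis
          using ge[of x] by (meson ereal_less_eq(3) order_trans)
      qed
      then have "ereal \<alpha> \<le> (INF x. ?L x \<psi>)"
        by (intro INF_greatest)
      also have "\<dots> \<le> (SUP \<psi>\<in>Psi_lsc. INF x. ?L x \<psi>)"
        using Phi_lsc_convex_combination[OF \<psi> t] by (intro SUP_upper) (simp add: \<psi>_def)
      finally show ?thesis .
    qed
    have "(INF x. f x) \<le> (SUP \<psi>\<in>Psi_lsc. INF x. ?L x \<psi>)"
    proof (rule ccontr)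
      assume "\<not> (INF x. f x) \<le> (SUP \<psi>\<in>Psi_lsc. INF x. ?L x \<psi>)"
      then obtain \<alpha> where "(SUP \<psi>\<in>Psi_lsc. INF x. ?L x \<psi>) < ereal \<alpha>" "ereal \<alpha> < (INF x. f x)"
        using ereal_dense2 by (auto simp: not_le)
      then show False
        using le[of \<alpha>] by simp
    qed
    \<comment> \<open>This is weak duality, valid for any function of two variables.\<close>
    moreover have "(SUP \<psi>\<in>Psi_lsc. INF x. ?L x \<psi>) \<le> (INF x. SUP \<psi>\<in>Psi_lsc. ?L x \<psi>)"
      by (intro SUP_least INF_greatest) (meson INF_lower SUP_upper UNIV_I order_trans)
    ultimately show ?ii
      unfolding sup by (auto intro: antisym)
  next
    assume ii: ?ii
    show ?i
    proof (intro allI impI)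
      fix \<alpha> :: real
      assume "ereal \<alpha> < (INF x. SUP \<psi>\<in>Psi_lsc. ?L x \<psi>)"
      then have "ereal \<alpha> < (SUP \<psi>\<in>Psi_lsc. INF x. ?L x \<psi>)"
        using ii by simp
      then obtain \<psi> where \<psi>: "\<psi> \<in> Psi_lsc" "ereal \<alpha> < (INF x. ?L x \<psi>)"
        unfolding less_SUP_iff by blast
      have "ereal \<alpha> \<le> ?L x \<psi>" for x
        using \<psi>(2) INF_lower[of x UNIV "\<lambda>x. ?L x \<psi>"] by (simp add: less_imp_le order_less_le_trans)
      then have "(\<lambda>_. \<alpha>) \<in> supp Phi_lsc (\<lambda>x. ?L x \<psi>)"
        by (simp add: supp_def const_in_Phi_lsc)
      \<comment> \<open>The strict sublevel set of a constant at its own value is empty, so the same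
        \<psi> and the same minorant serve for both indices.\<close>
      moreover have "strict_sublevel (\<lambda>_::'a. \<alpha>) \<alpha> \<inter> strict_sublevel (\<lambda>_. \<alpha>) \<alpha> = {}"
        by (simp add: strict_sublevel_def)
      ultimately show "\<exists>\<psi>1\<in>Psi_lsc. \<exists>\<psi>2\<in>Psi_lsc.
          \<exists>\<phi>1\<in>supp Phi_lsc (\<lambda>x. ?L x \<psi>1). \<exists>\<phi>2\<in>supp Phi_lsc (\<lambda>x. ?L x \<psi>2).
            strict_sublevel \<phi>1 \<alpha> \<inter> strict_sublevel \<phi>2 \<alpha> = {}"
        using \<psi>(1) by blast
    qed
  qed
qed

end
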